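(* Consider the model $X_i=\mu\Delta+\beta\tau_i+\tau_i^{1/2}\epsilon_i$, $i=1,\dots,n$, where $\epsilon_1,\dots,\epsilon_n$ are iid standard Normal, independent of the positive random variables $(\tau_1,\ldots,\tau_n)$, which have an arbitrary distribution whose joint Laplace transform has a known form. Then the marginal likelihood is given by $$\mathscr L(\mathbf X|\vartheta)=\frac{e^{n\bar A\beta}}{\pi^n}\int_{\mathbb R_+^n}E\left[\prod_{i=1}^ne^{-(y_i^2/2+\beta^2/2)\tau_i}\right]\prod_{i=1}^n\cos(y_i|A_i|)\,dy_i,$$ where $E\left[\prod_{i=1}^ne^{-(y_i^2/2+\beta^2/2)\tau_i}\right]$ is the joint Laplace transform of $(\tau_1,\ldots,\tau_n)$ evaluated at $\omega_i=y_i^2/2+\beta^2/2$, $i=1,\ldots,n$.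
   Context: $\mu,\beta\in\mathbb R$, $\Delta>0$; $\vartheta$ denotes all parameters; $A_i=X_i-\mu\Delta$, $\bar A=n^{-1}\sum_{i=1}^nA_i$. The marginal likelihood is $$\mathscr L(\mathbf X|\vartheta)=E\left[\prod_{i=1}^n\phi(X_i|\mu\Delta+\beta\tau_i,\tau_i)\right],\qquad \phi(X_i|\mu\Delta+\beta\tau_i,\tau_i)=e^{A_i\beta}\frac1{\sqrt{2\pi}}\tau_i^{-1/2}e^{-A_i^2/(2\tau_i)}e^{-\tau_i\beta^2/2},$$ the expectation being over the joint law of $(\tau_1,\dots,\tau_n)$ with the data $X_i$ held fixed.
   Formalization: The integral over the orthant need not converge absolutely: it is read as a limit over growing boxes when all A_i are nonzero (almost surely so), and as a Lebesgue integral whenever that exists; data with some A_i = 0 and a non-integrable integrand are excluded. *)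

theory Defs
  imports "HOL-Probability.Probability"
begin

text \<open>
  Vectors in \<open>n\<close> dimensions are functions on nat restricted to the index set \<open>{1..n}\<close>, and
  Lebesgue measure on them is the product measure \<open>PiM {1..n} (\<lambda>_. lborel)\<close>.
\<close>

text \<open>The normal density at \<open>x\<close> with mean \<open>m\<close> and \<^emph>\<open>variance\<close> \<open>v\<close>; the library density takes
  the standard deviation instead.\<close>

definition \<phi> :: "real \<Rightarrow> real \<Rightarrow> real \<Rightarrow> real" where
  "\<phi> x m v = normal_density m (sqrt v) x"

definition resid :: "real \<Rightarrow> real \<Rightarrow> (nat \<Rightarrow> real) \<Rightarrow> nat \<Rightarrow> real" where
  "resid \<mu> \<Delta> x i = x i - \<mu> * \<Delta>"

definition mean_resid :: "nat \<Rightarrow> real \<Rightarrow> real \<Rightarrow> (nat \<Rightarrow> real) \<Rightarrow> real" where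
  "mean_resid n \<mu> \<Delta> x = (\<Sum>i=1..n. resid \<mu> \<Delta> x i) / real n"

text \<open>The data \<open>x\<close> are held fixed; the expectation is over \<open>\<tau>\<close> only.\<close>

definition marginal_likelihood ::
  "'w measure \<Rightarrow> nat \<Rightarrow> real \<Rightarrow> real \<Rightarrow> real \<Rightarrow> (nat \<Rightarrow> 'w \<Rightarrow> real) \<Rightarrow> (nat \<Rightarrow> real) \<Rightarrow> real" where
  "marginal_likelihood M n \<mu> \<Delta> \<beta> \<tau> x =
     (\<integral>\<omega>. (\<Prod>i=1..n. \<phi> (x i) (\<mu> * \<Delta> + \<beta> * \<tau> i \<omega>) (\<tau> i \<omega>)) \<partial>M)"

definition joint_laplace ::
  "'w measure \<Rightarrow> nat \<Rightarrow> (nat \<Rightarrow> 'w \<Rightarrow> real) \<Rightarrow> (nat \<Rightarrow> real) \<Rightarrow> real" where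
  "joint_laplace M n \<tau> s = (\<integral>\<omega>. (\<Prod>i=1..n. exp (- s i * \<tau> i \<omega>)) \<partial>M)"

definition cos_integrand ::
  "'w measure \<Rightarrow> nat \<Rightarrow> real \<Rightarrow> (nat \<Rightarrow> 'w \<Rightarrow> real) \<Rightarrow> (nat \<Rightarrow> real) \<Rightarrow> (nat \<Rightarrow> real) \<Rightarrow> real" where
  "cos_integrand M n \<beta> \<tau> a y =
     joint_laplace M n \<tau> (\<lambda>i. (y i)\<^sup>2 / 2 + \<beta>\<^sup>2 / 2) * (\<Prod>i=1..n. cos (y i * \<bar>a i\<bar>))"

definition orthant :: "nat \<Rightarrow> (nat \<Rightarrow> real) set" where
  "orthant n = (\<Pi>\<^sub>E i\<in>{1..n}. {0..})"

definition orthant_box :: "nat \<Rightarrow> (nat \<Rightarrow> real) \<Rightarrow> (nat \<Rightarrow> real) set" where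
  "orthant_box n R = (\<Pi>\<^sub>E i\<in>{1..n}. {0..R i})"

text \<open>The filter of \<open>R\<^sub>1, \<dots>, R\<^sub>n\<close> tending to infinity independently of each other.\<close>

definition sides_at_top :: "nat \<Rightarrow> (nat \<Rightarrow> real) filter" where
  "sides_at_top n = (INF r::real. principal {R. \<forall>i\<in>{1..n}. r \<le> R i})"

text \<open>
  The improper Riemann-type integral over the orthant: the limit of the Lebesgue integrals over
  the boxes \<open>[0,R\<^sub>1] \<times> \<dots> \<times> [0,R\<^sub>n]\<close>. It coincides with the Lebesgue integral over the orthant
  whenever the latter exists, but also covers conditionally convergent integrals. These do occur
  below: for \<open>\<beta> = 0\<close> and \<open>n = 1\<close> the integrand is absolutely integrable only if
  \<open>\<tau> powr (-1/2)\<close> has finite expectation.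
\<close>

definition has_orthant_integral :: "nat \<Rightarrow> ((nat \<Rightarrow> real) \<Rightarrow> real) \<Rightarrow> real \<Rightarrow> bool" where
  "has_orthant_integral n f I \<longleftrightarrow>
     (\<forall>R. set_integrable (PiM {1..n} (\<lambda>_. lborel)) (orthant_box n R) f) \<and>
     ((\<lambda>R. LINT y:orthant_box n R|PiM {1..n} (\<lambda>_. lborel). f y) \<longlongrightarrow> I) (sides_at_top n)"

end

theory Submission
  imports Defs
begin

text \<open>For fixed \<open>t > 0\<close> the normal density with variance \<open>t\<close>, taken at distance \<open>a - \<beta> * t\<close> from its
mean, is up to the factor \<open>exp (a * \<beta>) / pi\<close> the half-line integral of
\<open>exp (- (y\<^sup>2 / 2 + \<beta>\<^sup>2 / 2) * t) * cos (y * \<bar>a\<bar>)\<close>: this is the Fourier transform of a Gaussian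
(\<open>normal_density_eq_cos_integral\<close>). Hence the marginal likelihood is the expectation of
a product of half-line integrals (\<open>marginal_likelihood_eq_cos_integrals\<close>), and the asserted formula
arises from taking the expectation inside the integral over the orthant, where it turns the
exponentials into the joint Laplace transform. All the work lies in justifying this exchange, since
nothing is assumed about the distribution of \<open>\<tau>\<close> near 0.

If no residual vanishes, Fubini holds on bounded boxes, and letting the boxes grow is a matter of
dominated convergence: the oscillation of the cosine bounds the truncated integrals by \<open>1 / \<bar>a\<bar>\<close>,
uniformly in \<open>t\<close> (\<open>abs_damped_cos_integral_le\<close>, \<open>has_orthant_integral_cos_integrand\<close>).

If the integrand is absolutely integrable over the orthant, residuals equal to 0 are possible and
there is no such bound. But then the Laplace transform without its cosines is integrable as well
(\<open>integrable_prod_half_line_of_set_integrable\<close>), which is what Fubini on the whole orthant requires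
(\<open>set_integral_cos_integrand_PiE\<close>).

Almost surely no residual vanishes, because \<open>\<beta> * \<tau> + sqrt \<tau> * \<epsilon> = 0\<close> would make the normal variable
\<open>\<epsilon>\<close> equal to a function of the independent \<open>\<tau>\<close> (\<open>AE_neq_function_of_independent\<close>).\<close>

section \<open>The one-dimensional cosine transform\<close>

text \<open>The Laplace kernel at \<open>y\<^sup>2 / 2 + \<beta>\<^sup>2 / 2\<close> times the cosine: for one coordinate, the integrand of the
formula before the expectation is taken. With \<open>a = 0\<close> it is the bare Laplace kernel, which
dominates all the others.\<close>

definition damped_cos :: "real \<Rightarrow> real \<Rightarrow> real \<Rightarrow> real \<Rightarrow> real" where
  "damped_cos \<beta> t a y = exp (- ((y\<^sup>2 / 2 + \<beta>\<^sup>2 / 2) * t)) * cos (y * \<bar>a\<bar>)"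

lemma measurable_damped_cos [measurable]:
  assumes [measurable]: "f \<in> borel_measurable N" "g \<in> borel_measurable N"
  shows "(\<lambda>z. damped_cos \<beta> (f z) a (g z)) \<in> borel_measurable N"
  unfolding damped_cos_def by measurable

lemma abs_damped_cos_le: "\<bar>damped_cos \<beta> t a y\<bar> \<le> damped_cos \<beta> t 0 y"
  by (simp add: damped_cos_def abs_mult mult_left_le)

lemma damped_cos_factor:
  "damped_cos \<beta> t a y = exp (- (\<beta>\<^sup>2 / 2 * t)) * (exp (- (y\<^sup>2 / 2 * t)) * cos (y * \<bar>a\<bar>))"
proof -
  have "- ((y\<^sup>2 / 2 + \<beta>\<^sup>2 / 2) * t) = - (\<beta>\<^sup>2 / 2 * t) + - (y\<^sup>2 / 2 * t)"
    by (simp add: algebra_simps)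
  then show ?thesis
    unfolding damped_cos_def by (simp only: exp_add mult.assoc)
qed

text \<open>The real part of the characteristic function of the standard normal distribution.\<close>

lemma std_normal_cos_transform:
  "integrable lborel (\<lambda>x. std_normal_density x * cos (s * x))"
  "(LINT x|lborel. std_normal_density x * cos (s * x)) = exp (- s\<^sup>2 / 2)"
proof -
  interpret real_distribution std_normal_distribution by (rule real_dist_normal_dist)
  have int: "complex_integrable std_normal_distribution (\<lambda>x. iexp (s * x))"
    by (intro integrable_iexp) auto
  then have "integrable std_normal_distribution (\<lambda>x. cos (s * x))"
    using integrable_Re[OF int] by (simp add: Re_exp)
  then show "integrable lborel (\<lambda>x. std_normal_density x * cos (s * x))"
    by (simp add: integrable_density)
  have "exp (- s\<^sup>2 / 2) = Re (char std_normal_distribution s)"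
    by (simp add: char_std_normal_distribution)
  also have "\<dots> = (LINT x|std_normal_distribution. cos (s * x))"
    unfolding char_def using integral_Re[OF int] by (simp add: Re_exp)
  also have "\<dots> = (LINT x|lborel. std_normal_density x * cos (s * x))"
    by (subst integral_density) auto
  finally show "(LINT x|lborel. std_normal_density x * cos (s * x)) = exp (- s\<^sup>2 / 2)" ..
qed

lemma gaussian_cos_integral:
  fixes t a :: real
  assumes "t > 0"
  shows "integrable lborel (\<lambda>y. exp (- (y\<^sup>2 / 2 * t)) * cos (y * a))"
    and "(LINT y|lborel. exp (- (y\<^sup>2 / 2 * t)) * cos (y * a)) = sqrt (2 * pi / t) * exp (- a\<^sup>2 / (2 * t))"
proof -
  define g where "g x = std_normal_density x * cos (a / sqrt t * x)" for x
  have g: "g (0 + sqrt t * y) = exp (- (y\<^sup>2 / 2 * t)) * cos (y * a) / sqrt (2 * pi)" for y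
    using assms by (simp add: g_def std_normal_density_def power_mult_distrib field_simps)
  have "integrable lborel (\<lambda>y. sqrt (2 * pi) * g (0 + sqrt t * y))"
    unfolding g_def using assms by (intro integrable_mult_right lborel_integrable_real_affine std_normal_cos_transform) auto
  then show "integrable lborel (\<lambda>y. exp (- (y\<^sup>2 / 2 * t)) * cos (y * a))"
    unfolding g by simp
  have "exp (- (a / sqrt t)\<^sup>2 / 2) = \<bar>sqrt t\<bar> *\<^sub>R (LINT y|lborel. g (0 + sqrt t * y))"
    using assms unfolding std_normal_cos_transform(2)[symmetric] g_def
    by (intro lborel_integral_real_affine) auto
  also have "\<dots> = sqrt t / sqrt (2 * pi) * (LINT y|lborel. exp (- (y\<^sup>2 / 2 * t)) * cos (y * a))"
    using assms unfolding g by simp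
  finally show "(LINT y|lborel. exp (- (y\<^sup>2 / 2 * t)) * cos (y * a)) = sqrt (2 * pi / t) * exp (- a\<^sup>2 / (2 * t))"
    using assms by (simp add: field_simps power_divide real_sqrt_divide)
qed

lemma set_lebesgue_integral_even:
  fixes f :: "real \<Rightarrow> real"
  assumes int: "integrable lborel f" and even: "\<And>x. f (- x) = f x"
  shows "(LINT x:{0..}|lborel. f x) = (LINT x|lborel. f x) / 2"
proof -
  have "has_bochner_integral lborel (\<lambda>x. indicator {0..} x *\<^sub>R f x) (LINT x:{0..}|lborel. f x)"
    using int unfolding set_lebesgue_integral_def
    by (intro has_bochner_integral_integrable integrable_mult_indicator) auto
  from has_bochner_integral_even_function[OF this even]
  show ?thesis by (simp add: has_bochner_integral_iff)
qed

lemma damped_cos_integrable: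
  assumes "t > 0" and [measurable]: "A \<in> sets borel"
  shows "set_integrable lborel A (damped_cos \<beta> t a)"
proof -
  have "integrable lborel (\<lambda>y. exp (- (\<beta>\<^sup>2 / 2 * t)) * (exp (- (y\<^sup>2 / 2 * t)) * cos (y * \<bar>a\<bar>)))"
    using gaussian_cos_integral(1)[OF assms(1)] by simp
  then show ?thesis unfolding set_integrable_def
    by (intro integrable_mult_indicator)
       (auto simp: damped_cos_factor[abs_def])
qed

text \<open>The kernel is even in \<open>y\<close>, so the half line carries half of the Gaussian cosine transform.\<close>

lemma damped_cos_half_line:
  assumes "t > 0"
  shows "(LINT y:{0..}|lborel. damped_cos \<beta> t a y)
    = sqrt (pi / (2 * t)) * exp (- a\<^sup>2 / (2 * t) - \<beta>\<^sup>2 / 2 * t)"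
proof -
  have e: "damped_cos \<beta> t a = (\<lambda>y. exp (- (\<beta>\<^sup>2 / 2 * t)) * (exp (- (y\<^sup>2 / 2 * t)) * cos (y * \<bar>a\<bar>)))"
    by (rule ext) (rule damped_cos_factor)
  have "(LINT y:{0..}|lborel. damped_cos \<beta> t a y) = (LINT y|lborel. damped_cos \<beta> t a y) / 2"
    using damped_cos_integrable[OF assms, of UNIV \<beta> a]
    by (intro set_lebesgue_integral_even) (auto simp: set_integrable_def damped_cos_def)
  also have "\<dots> = exp (- (\<beta>\<^sup>2 / 2 * t)) * (sqrt (2 * pi / t) * exp (- a\<^sup>2 / (2 * t))) / 2"
    unfolding e using gaussian_cos_integral(2)[OF assms, of "\<bar>a\<bar>"] by simp
  also have "sqrt (2 * pi / t) = 2 * sqrt (pi / (2 * t))"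
    by (rule real_sqrt_unique) (use assms in \<open>auto simp: power_mult_distrib\<close>)
  finally show ?thesis
    by (simp only: diff_conv_add_uminus exp_add) simp
qed

text \<open>Completing the square splits the exponent of the normal density into \<open>a \<beta>\<close>, which leaves the
integral, and the exponent that the cosine transform produces.\<close>

lemma normal_density_eq_cos_integral:
  assumes "t > 0"
  shows "\<phi> (m + a) (m + \<beta> * t) t = exp (a * \<beta>) / pi * (LINT y:{0..}|lborel. damped_cos \<beta> t a y)"
proof -
  have "\<phi> (m + a) (m + \<beta> * t) t = 1 / sqrt (2 * pi * t) * exp (- (a - \<beta> * t)\<^sup>2 / (2 * t))"
    using assms by (simp add: \<phi>_def normal_density_def)
  also have "- (a - \<beta> * t)\<^sup>2 / (2 * t) = a * \<beta> + (- a\<^sup>2 / (2 * t) - \<beta>\<^sup>2 / 2 * t)"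
    using assms by (simp add: field_simps power2_eq_square)
  also have "1 / sqrt (2 * pi * t) = sqrt (pi / (2 * t)) / pi"
    using assms by (simp add: real_sqrt_divide real_sqrt_mult field_simps)
  finally show ?thesis
    unfolding damped_cos_half_line[OF assms] exp_add by simp
qed

text \<open>The oscillation of the cosine bounds the truncated integrals uniformly in \<open>t\<close>, whereas the
absolute integrals over the half line grow like \<open>t powr (-1/2)\<close> when \<open>t\<close> tends to 0, and the \<open>\<tau> i\<close>
need not have finite moments of that order. Integration by parts gives the bound: the exponential
factor \<open>e y\<close> decreases on \<open>{0..R}\<close>, so the boundary term is at most \<open>e R / \<bar>a\<bar>\<close> and the remaining
integral at most the total decrease \<open>(e 0 - e R) / \<bar>a\<bar>\<close>.\<close>

lemma abs_damped_cos_integral_le: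
  assumes "t > 0" and "a \<noteq> 0"
  shows "\<bar>LINT y:{0..R}|lborel. damped_cos \<beta> t a y\<bar> \<le> 1 / \<bar>a\<bar>"
proof (cases "R \<ge> 0")
  case True
  define b where "b = \<bar>a\<bar>"
  define e where "e y = exp (- ((y\<^sup>2 / 2 + \<beta>\<^sup>2 / 2) * t))" for y
  have b: "b > 0" using assms b_def by simp
  \<comment> \<open>The boundary term of the integration by parts, and a primitive that measures the decrease of \<open>e\<close>.\<close>
  have D: "((\<lambda>y. e y * sin (y * b) / b) has_vector_derivative
      damped_cos \<beta> t a y - y * t * e y * sin (y * b) / b) (at y within {0..R})" for y
    unfolding e_def damped_cos_def b_def[symmetric] has_real_derivative_iff_has_vector_derivative[symmetric]
    using b by (auto intro!: derivative_eq_intros simp: field_simps power2_eq_square)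
  have D': "((\<lambda>y. - e y / b) has_vector_derivative y * t * e y / b) (at y within {0..R})" for y
    unfolding e_def has_real_derivative_iff_has_vector_derivative[symmetric]
    using b by (auto intro!: derivative_eq_intros simp: field_simps power2_eq_square)
  have 1: "((\<lambda>y. damped_cos \<beta> t a y - y * t * e y * sin (y * b) / b) has_integral
      e R * sin (R * b) / b) {0..R}"
    using fundamental_theorem_of_calculus[OF True D] by simp
  have 2: "((\<lambda>y. y * t * e y / b) has_integral (e 0 - e R) / b) {0..R}"
    using fundamental_theorem_of_calculus[OF True D'] by (simp add: diff_divide_distrib)
  have 3: "((\<lambda>y. damped_cos \<beta> t a y) has_integral (LINT y:{0..R}|lborel. damped_cos \<beta> t a y)) {0..R}"
    using set_borel_integral_eq_integral[OF damped_cos_integrable[OF assms(1), of "{0..R}" \<beta> a]]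
    by (auto simp: has_integral_iff)
  have 4: "((\<lambda>y. y * t * e y * sin (y * b) / b) has_integral
      (LINT y:{0..R}|lborel. damped_cos \<beta> t a y) - e R * sin (R * b) / b) {0..R}"
    using has_integral_diff[OF 3 1] by simp
  have "norm ((LINT y:{0..R}|lborel. damped_cos \<beta> t a y) - e R * sin (R * b) / b) \<le> (e 0 - e R) / b"
  proof -
    have "norm (integral {0..R} (\<lambda>y. y * t * e y * sin (y * b) / b)) \<le> integral {0..R} (\<lambda>y. y * t * e y / b)"
    proof (rule Henstock_Kurzweil_Integration.integral_norm_bound_integral)
      fix y assume "y \<in> {0..R}"
      then have "0 \<le> y * t * e y / b"
        using b assms by (simp add: e_def)
      then have "y * t * e y / b * \<bar>sin (y * b)\<bar> \<le> y * t * e y / b"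
        by (intro mult_left_le) auto
      moreover have "norm (y * t * e y * sin (y * b) / b) = \<bar>y * t * e y / b\<bar> * \<bar>sin (y * b)\<bar>"
        by (simp add: abs_mult)
      ultimately show "norm (y * t * e y * sin (y * b) / b) \<le> y * t * e y / b"
        using \<open>0 \<le> y * t * e y / b\<close> by (simp only: abs_of_nonneg)
    qed (use 4 2 in \<open>auto simp: has_integral_iff\<close>)
    then show ?thesis
      unfolding integral_unique[OF 4] integral_unique[OF 2] .
  qed
  moreover have "\<bar>e R * sin (R * b) / b\<bar> \<le> e R / b"
    using b by (auto simp: abs_mult e_def divide_le_cancel mult_left_le)
  moreover have "e 0 / b \<le> 1 / b"
    using b assms by (simp add: e_def divide_le_cancel)
  ultimately show ?thesis unfolding b_def[symmetric] diff_divide_distrib real_norm_def by linarith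
qed (simp add: set_lebesgue_integral_def)

text \<open>Replacing \<open>cos\<close> by \<open>cos\<^sup>2\<close> loses at most half of the half-line integral of the Laplace kernel. By
the double angle formula what is added to that half is half a cosine transform of a Gaussian at
frequency \<open>2 a\<close>, and this is positive.\<close>

lemma damped_cos_squared_half_line_ge:
  assumes "t > 0"
  shows "set_integrable lborel {0..} (\<lambda>y. damped_cos \<beta> t 0 y * (cos (y * \<bar>a\<bar>))\<^sup>2)"
    and "(LINT y:{0..}|lborel. damped_cos \<beta> t 0 y) / 2
      \<le> (LINT y:{0..}|lborel. damped_cos \<beta> t 0 y * (cos (y * \<bar>a\<bar>))\<^sup>2)"
proof -
  have double_angle: "damped_cos \<beta> t 0 y * (cos (y * \<bar>a\<bar>))\<^sup>2
      = (damped_cos \<beta> t 0 y + damped_cos \<beta> t (2 * a) y) / 2" for y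
    using cos_double_cos[of "y * \<bar>a\<bar>"]
    by (simp add: damped_cos_def abs_mult mult_ac) (simp add: algebra_simps)
  note int = damped_cos_integrable[OF assms, of "{0..}"]
  show "set_integrable lborel {0..} (\<lambda>y. damped_cos \<beta> t 0 y * (cos (y * \<bar>a\<bar>))\<^sup>2)"
    unfolding double_angle by (intro set_integrable_divide set_integral_add int) auto
  have "0 \<le> (LINT y:{0..}|lborel. damped_cos \<beta> t (2 * a) y)"
    using assms by (simp add: damped_cos_half_line)
  then show "(LINT y:{0..}|lborel. damped_cos \<beta> t 0 y) / 2
      \<le> (LINT y:{0..}|lborel. damped_cos \<beta> t 0 y * (cos (y * \<bar>a\<bar>))\<^sup>2)"
    unfolding double_angle using int by (simp add: set_integral_add)
qed

section \<open>Absolutely continuous variables avoid independent ones\<close>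

text \<open>Given the value \<open>t\<close> of \<open>T\<close>, the variable \<open>E\<close> still has a density, so it hits the single point
\<open>g t\<close> with probability 0; Fubini removes the conditioning.\<close>

lemma (in prob_space) AE_neq_function_of_independent:
  fixes E T :: "'a \<Rightarrow> real" and g :: "real \<Rightarrow> real"
  assumes dist: "distributed M lborel E f" and indep: "indep_var borel E borel T"
    and [measurable]: "g \<in> borel_measurable borel"
  shows "AE \<omega> in M. E \<omega> \<noteq> g (T \<omega>)"
proof -
  have [measurable]: "E \<in> borel_measurable M" "T \<in> borel_measurable M"
    and joint: "distr M borel E \<Otimes>\<^sub>M distr M borel T = distr M (borel \<Otimes>\<^sub>M borel) (\<lambda>\<omega>. (E \<omega>, T \<omega>))"
    using indep unfolding indep_var_distribution_eq by auto
  interpret DE: prob_space "distr M borel E" by (rule prob_space_distr) simp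
  interpret DT: prob_space "distr M borel T" by (rule prob_space_distr) simp
  interpret D: pair_sigma_finite "distr M borel E" "distr M borel T" ..
  have [measurable]: "f \<in> borel_measurable borel"
    using distributed_borel_measurable[OF dist] by simp
  have "distr M borel E = distr M lborel E"
    by (rule distr_cong) auto
  also have "\<dots> = density lborel f"
    using dist by (rule distributed_distr_eq_density)
  finally have E: "distr M borel E = density lborel f" .
  have "AE e in distr M borel E. e \<noteq> g t" for t
    unfolding E by (subst AE_density) (auto intro: AE_mp[OF AE_lborel_singleton[of "g t"]])
  then have "AE t in distr M borel T. AE e in distr M borel E. e \<noteq> g t"
    by simp
  moreover have neq: "{p \<in> space (distr M borel E \<Otimes>\<^sub>M distr M borel T). fst p \<noteq> g (snd p)}
      \<in> sets (distr M borel E \<Otimes>\<^sub>M distr M borel T)"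
    by measurable
  ultimately have "AE e in distr M borel E. AE t in distr M borel T. e \<noteq> g t"
    by (subst D.AE_commute) auto
  then have "AE p in distr M (borel \<Otimes>\<^sub>M borel) (\<lambda>\<omega>. (E \<omega>, T \<omega>)). fst p \<noteq> g (snd p)"
    unfolding joint[symmetric] by (intro D.AE_pair_measure neq) auto
  then show ?thesis
    by (subst (asm) AE_distr_iff) auto
qed

section \<open>Exchanging expectation and integration over a rectangle\<close>

text \<open>The filter has a countable base, so limits along it can be tested on sequences, which is the form
that dominated convergence needs.\<close>

lemma tendsto_sides_at_topI_sequentially:
  assumes seq: "\<And>R :: nat \<Rightarrow> nat \<Rightarrow> real.
      (\<And>i. i \<in> {1..n} \<Longrightarrow> filterlim (\<lambda>k. R k i) at_top sequentially) \<Longrightarrow> (\<lambda>k. f (R k)) \<longlonglongrightarrow> l"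
  shows "(f \<longlongrightarrow> l) (sides_at_top n)"
proof (rule topological_tendstoI)
  fix S assume S: "open S" "l \<in> S"
  show "eventually (\<lambda>R. f R \<in> S) (sides_at_top n)"
  proof (rule ccontr)
    assume *: "\<not> ?thesis"
    have "\<exists>R. (\<forall>i\<in>{1..n}. real k \<le> R i) \<and> f R \<notin> S" for k :: nat
    proof (rule ccontr)
      assume "\<nexists>R. (\<forall>i\<in>{1..n}. real k \<le> R i) \<and> f R \<notin> S"
      then have "eventually (\<lambda>R. f R \<in> S) (principal {R. \<forall>i\<in>{1..n}. real k \<le> R i})"
        by (auto simp: eventually_principal)
      then have "eventually (\<lambda>R. f R \<in> S) (sides_at_top n)"
        unfolding sides_at_top_def by (rule eventually_INF1[rotated]) auto
      with * show False ..
    qed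
    then obtain R where R: "\<And>k i. i \<in> {1..n} \<Longrightarrow> real k \<le> R k i" "\<And>k. f (R k) \<notin> S"
      by metis
    have "(\<lambda>k. f (R k)) \<longlonglongrightarrow> l"
      by (rule seq) (auto intro!: filterlim_at_top_mono[OF filterlim_real_sequentially] always_eventually R(1))
    from topological_tendstoD[OF this S] R(2) show False
      by (auto simp: eventually_sequentially)
  qed
qed

lemma cos_integrand_eq_expectation:
  "cos_integrand M n \<beta> \<tau> a y = (\<integral>\<omega>. (\<Prod>i=1..n. damped_cos \<beta> (\<tau> i \<omega>) (a i) (y i)) \<partial>M)"
  unfolding cos_integrand_def joint_laplace_def damped_cos_def
  by (simp only: prod.distrib integral_mult_left_zero mult_minus_left)

lemma indicator_PiE_eq_prod:
  fixes y :: "'i \<Rightarrow> 'b"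
  assumes "finite I" "y \<in> extensional I"
  shows "indicator (PiE I A) y = (\<Prod>i\<in>I. indicator (A i) (y i) :: real)"
  using assms by (auto simp: indicator_def PiE_iff prod_zero_iff)

interpretation lborel_product: product_sigma_finite "\<lambda>_::nat. lborel :: real measure"
  by standard

text \<open>Fubini over a measurable rectangle, bounded or not. For fixed \<open>\<omega>\<close> the integral over the rectangle
factors into one-dimensional ones, and the kernel with \<open>a = 0\<close> is a common nonnegative majorant,
so it suffices that the integrals of the majorant have a finite expectation.\<close>

lemma
  fixes \<tau> :: "nat \<Rightarrow> 'w \<Rightarrow> real"
  assumes "prob_space M"
    and [measurable]: "\<And>i. \<tau> i \<in> borel_measurable M"
    and pos: "\<And>i \<omega>. \<tau> i \<omega> > 0"
    and [measurable]: "\<And>i. A i \<in> sets borel"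
    and int: "integrable M (\<lambda>\<omega>. \<Prod>i=1..n. LINT y:A i|lborel. damped_cos \<beta> (\<tau> i \<omega>) 0 y)"
  shows set_integrable_cos_integrand_PiE:
      "set_integrable (PiM {1..n} (\<lambda>_. lborel)) (PiE {1..n} A) (cos_integrand M n \<beta> \<tau> a)"
    and set_integral_cos_integrand_PiE:
      "(LINT y:PiE {1..n} A|PiM {1..n} (\<lambda>_. lborel). cos_integrand M n \<beta> \<tau> a y)
        = (\<integral>\<omega>. (\<Prod>i=1..n. LINT y:A i|lborel. damped_cos \<beta> (\<tau> i \<omega>) (a i) y) \<partial>M)"
proof -
  interpret prob_space M by fact
  let ?P = "PiM {1..n} (\<lambda>_. lborel :: real measure)"
  interpret P: sigma_finite_measure ?P
    by (rule lborel_product.sigma_finite) simp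
  interpret Q: pair_sigma_finite M ?P ..
  define H where "H a \<omega> y = (\<Prod>i=1..n. indicator (A i) (y i) * damped_cos \<beta> (\<tau> i \<omega>) (a i) (y i))"
    for a :: "nat \<Rightarrow> real" and \<omega> y
  have [measurable]: "(\<lambda>z. H a (fst z) (snd z)) \<in> borel_measurable (M \<Otimes>\<^sub>M ?P)" for a
    unfolding H_def by measurable
  have intA: "integrable lborel (\<lambda>y. indicator (A i) y * damped_cos \<beta> (\<tau> i \<omega>) c y)" for i \<omega> c
    using damped_cos_integrable[OF pos, of "A i" \<beta> i \<omega> c] by (simp add: set_integrable_def)
  have int_H: "integrable ?P (H a \<omega>)" for a \<omega>
    unfolding H_def by (intro lborel_product.product_integrable_prod intA) auto
  have integral_H: "(\<integral>y. H a \<omega> y \<partial>?P) = (\<Prod>i=1..n. LINT y:A i|lborel. damped_cos \<beta> (\<tau> i \<omega>) (a i) y)" for a \<omega>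
    unfolding H_def
    by (subst lborel_product.product_integral_prod) (auto intro: intA simp: set_lebesgue_integral_def)
  have abs_H: "\<bar>H a \<omega> y\<bar> \<le> H (\<lambda>_. 0) \<omega> y" for a \<omega> y
    unfolding H_def abs_prod
    by (intro prod_mono) (auto simp: abs_mult abs_damped_cos_le mult_left_mono)
  have "integrable (M \<Otimes>\<^sub>M ?P) (\<lambda>z. H (\<lambda>_. 0) (fst z) (snd z))"
  proof (rule Q.Fubini_integrable)
    have "\<bar>H (\<lambda>_. 0) \<omega> y\<bar> = H (\<lambda>_. 0) \<omega> y" for \<omega> y
      using abs_H[of "\<lambda>_. 0" \<omega> y] by simp
    then show "integrable M (\<lambda>\<omega>. \<integral>y. norm (H (\<lambda>_. 0) (fst (\<omega>, y)) (snd (\<omega>, y))) \<partial>?P)"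
      using int by (simp only: fst_conv snd_conv real_norm_def integral_H)
  qed (auto simp: int_H simp del: One_nat_def)
  then have int_pair: "integrable (M \<Otimes>\<^sub>M ?P) (\<lambda>(\<omega>, y). H a \<omega> y)"
    by (rule Bochner_Integration.integrable_bound) (auto simp: split_beta' simp del: One_nat_def intro!: AE_I2 order_trans[OF abs_H abs_ge_self])
  have slice: "indicator (PiE {1..n} A) y *\<^sub>R cos_integrand M n \<beta> \<tau> a y = (\<integral>\<omega>. H a \<omega> y \<partial>M)"
    if "y \<in> space ?P" for y
    using that unfolding H_def cos_integrand_eq_expectation
    by (subst indicator_PiE_eq_prod) (auto simp: space_PiM PiE_iff prod.distrib)
  show "set_integrable ?P (PiE {1..n} A) (cos_integrand M n \<beta> \<tau> a)"
    unfolding set_integrable_def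
    using Q.integrable_snd[OF int_pair] by (subst Bochner_Integration.integrable_cong[OF refl slice])
  show "(LINT y:PiE {1..n} A|?P. cos_integrand M n \<beta> \<tau> a y)
        = (\<integral>\<omega>. (\<Prod>i=1..n. LINT y:A i|lborel. damped_cos \<beta> (\<tau> i \<omega>) (a i) y) \<partial>M)"
    unfolding set_lebesgue_integral_def[of ?P]
    using Q.Fubini_integral[OF int_pair]
    by (subst Bochner_Integration.integral_cong[OF refl slice]) (simp_all add: integral_H del: One_nat_def)
qed

section \<open>The marginal likelihood as an orthant integral\<close>

lemma marginal_likelihood_eq_cos_integrals:
  assumes pos: "\<And>i \<omega>. \<tau> i \<omega> > 0" and "n \<ge> 1"
  shows "marginal_likelihood M n \<mu> \<Delta> \<beta> \<tau> x = exp (real n * mean_resid n \<mu> \<Delta> x * \<beta>) / pi ^ n *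
    (\<integral>\<omega>. (\<Prod>i=1..n. LINT y:{0..}|lborel. damped_cos \<beta> (\<tau> i \<omega>) (resid \<mu> \<Delta> x i) y) \<partial>M)"
proof -
  have "\<phi> (x i) (\<mu> * \<Delta> + \<beta> * \<tau> i \<omega>) (\<tau> i \<omega>) = exp (resid \<mu> \<Delta> x i * \<beta>) / pi *
      (LINT y:{0..}|lborel. damped_cos \<beta> (\<tau> i \<omega>) (resid \<mu> \<Delta> x i) y)" for i \<omega>
    using normal_density_eq_cos_integral[OF pos, of "\<mu> * \<Delta>" "resid \<mu> \<Delta> x i" \<beta> i \<omega>]
    by (simp add: resid_def)
  moreover have "(\<Prod>i=1..n. exp (resid \<mu> \<Delta> x i * \<beta>) / pi) = exp (real n * mean_resid n \<mu> \<Delta> x * \<beta>) / pi ^ n"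
    using \<open>n \<ge> 1\<close> by (simp add: prod_dividef mean_resid_def exp_sum sum_distrib_right)
  ultimately show ?thesis
    unfolding marginal_likelihood_def by (simp only: prod.distrib integral_mult_right_zero)
qed

lemma measurable_damped_cos_integral [measurable]:
  assumes [measurable]: "f \<in> borel_measurable M" "A \<in> sets borel"
  shows "(\<lambda>\<omega>. LINT y:A|lborel. damped_cos \<beta> (f \<omega>) a y) \<in> borel_measurable M"
  unfolding set_lebesgue_integral_def by measurable

text \<open>On a bounded box Fubini applies because all integrals of the Laplace kernel are bounded by the
sides. The truncated cosine integrals are at most \<open>1 / \<bar>a i\<bar>\<close> whatever the sides and \<open>\<omega>\<close> are, so
dominated convergence lets the sides tend to infinity under the expectation.\<close>

lemma has_orthant_integral_cos_integrand:
  fixes \<tau> :: "nat \<Rightarrow> 'w \<Rightarrow> real"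
  assumes "prob_space M"
    and [measurable]: "\<And>i. \<tau> i \<in> borel_measurable M"
    and pos: "\<And>i \<omega>. \<tau> i \<omega> > 0"
    and nz: "\<And>i. i \<in> {1..n} \<Longrightarrow> a i \<noteq> 0"
  shows "has_orthant_integral n (cos_integrand M n \<beta> \<tau> a)
    (\<integral>\<omega>. (\<Prod>i=1..n. LINT y:{0..}|lborel. damped_cos \<beta> (\<tau> i \<omega>) (a i) y) \<partial>M)"
proof -
  interpret prob_space M by fact
  have bounded_0: "(LINT y:{0..R}|lborel. damped_cos \<beta> (\<tau> i \<omega>) 0 y) \<in> {0..max 0 R}" for R i \<omega>
  proof -
    have "(LINT y:{0..R}|lborel. damped_cos \<beta> (\<tau> i \<omega>) 0 y) \<le> (LINT y:{0..R}|lborel. 1)"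
      by (intro set_integral_mono damped_cos_integrable pos)
         (auto simp: damped_cos_def set_integrable_def emeasure_lborel_Icc_eq intro!: mult_nonneg_nonneg less_imp_le[OF pos])
    moreover have "(LINT y:{0..R}|lborel. damped_cos \<beta> (\<tau> i \<omega>) 0 y) \<ge> 0"
      unfolding set_lebesgue_integral_def by (intro integral_nonneg_AE) (auto simp: damped_cos_def)
    ultimately show ?thesis
      by (cases "R \<ge> 0") (auto simp: set_lebesgue_integral_def)
  qed
  have int: "integrable M (\<lambda>\<omega>. \<Prod>i=1..n. LINT y:{0..R i}|lborel. damped_cos \<beta> (\<tau> i \<omega>) 0 y)" for R
  proof (rule integrable_const_bound)
    show "AE \<omega> in M. norm (\<Prod>i=1..n. LINT y:{0..R i}|lborel. damped_cos \<beta> (\<tau> i \<omega>) 0 y)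
        \<le> (\<Prod>i=1..n. max 0 (R i))"
      using bounded_0 by (auto simp: abs_prod intro!: AE_I2 prod_mono)
  qed simp
  note box = set_integrable_cos_integrand_PiE[OF assms(1-3) _ int, of _ a]
    set_integral_cos_integrand_PiE[OF assms(1-3) _ int, of _ a]
  show ?thesis
    unfolding has_orthant_integral_def orthant_box_def
  proof (intro conjI allI)
    show "set_integrable (PiM {1..n} (\<lambda>_. lborel)) (\<Pi>\<^sub>E i\<in>{1..n}. {0..R i}) (cos_integrand M n \<beta> \<tau> a)" for R
      by (rule box(1)) simp
  next
    show "((\<lambda>R. LINT y:\<Pi>\<^sub>E i\<in>{1..n}. {0..R i}|PiM {1..n} (\<lambda>_. lborel). cos_integrand M n \<beta> \<tau> a y) \<longlongrightarrow>
      (\<integral>\<omega>. (\<Prod>i=1..n. LINT y:{0..}|lborel. damped_cos \<beta> (\<tau> i \<omega>) (a i) y) \<partial>M)) (sides_at_top n)"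
    proof (rule tendsto_sides_at_topI_sequentially)
      fix R :: "nat \<Rightarrow> nat \<Rightarrow> real"
      assume R: "\<And>i. i \<in> {1..n} \<Longrightarrow> filterlim (\<lambda>k. R k i) at_top sequentially"
      have "(\<lambda>k. \<integral>\<omega>. (\<Prod>i=1..n. LINT y:{0..R k i}|lborel. damped_cos \<beta> (\<tau> i \<omega>) (a i) y) \<partial>M)
        \<longlonglongrightarrow> (\<integral>\<omega>. (\<Prod>i=1..n. LINT y:{0..}|lborel. damped_cos \<beta> (\<tau> i \<omega>) (a i) y) \<partial>M)"
      proof (rule integral_dominated_convergence)
        show "integrable M (\<lambda>_. \<Prod>i=1..n. 1 / \<bar>a i\<bar>)" by simp
        show "AE \<omega> in M. norm (\<Prod>i=1..n. LINT y:{0..R k i}|lborel. damped_cos \<beta> (\<tau> i \<omega>) (a i) y)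
            \<le> (\<Prod>i=1..n. 1 / \<bar>a i\<bar>)" for k
          unfolding real_norm_def abs_prod
          by (intro AE_I2 prod_mono conjI abs_damped_cos_integral_le pos nz) auto
        show "AE \<omega> in M. (\<lambda>k. \<Prod>i=1..n. LINT y:{0..R k i}|lborel. damped_cos \<beta> (\<tau> i \<omega>) (a i) y)
            \<longlonglongrightarrow> (\<Prod>i=1..n. LINT y:{0..}|lborel. damped_cos \<beta> (\<tau> i \<omega>) (a i) y)"
          by (intro AE_I2 tendsto_prod filterlim_compose[OF tendsto_set_lebesgue_integral_at_top R]
              damped_cos_integrable pos) auto
      qed measurable
      then show "(\<lambda>k. LINT y:\<Pi>\<^sub>E i\<in>{1..n}. {0..R k i}|PiM {1..n} (\<lambda>_. lborel). cos_integrand M n \<beta> \<tau> a y)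
        \<longlonglongrightarrow> (\<integral>\<omega>. (\<Prod>i=1..n. LINT y:{0..}|lborel. damped_cos \<beta> (\<tau> i \<omega>) (a i) y) \<partial>M)"
        by (subst box(2)) simp_all
    qed
  qed
qed

text \<open>Absolute integrability of the integrand with its cosines, some of whose frequencies may be 0,
already forces that of the Laplace transform alone. Since \<open>cos\<^sup>2 \<le> \<bar>cos\<bar>\<close>, the integrand with
squared cosines is integrable too. It is nonnegative, so by Tonelli its integral is the expectation
of a product of one-dimensional integrals, each of which is at least half of that of the Laplace
kernel.\<close>

lemma integrable_prod_half_line_of_set_integrable:
  fixes \<tau> :: "nat \<Rightarrow> 'w \<Rightarrow> real"
  assumes "prob_space M"
    and [measurable]: "\<And>i. \<tau> i \<in> borel_measurable M"
    and pos: "\<And>i \<omega>. \<tau> i \<omega> > 0"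
    and int: "set_integrable (PiM {1..n} (\<lambda>_. lborel)) (orthant n) (cos_integrand M n \<beta> \<tau> a)"
  shows "integrable M (\<lambda>\<omega>. \<Prod>i=1..n. LINT y:{0..}|lborel. damped_cos \<beta> (\<tau> i \<omega>) 0 y)"
proof (rule integrableI_bounded)
  interpret prob_space M by fact
  let ?P = "PiM {1..n} (\<lambda>_. lborel :: real measure)"
  interpret P: sigma_finite_measure ?P
    by (rule lborel_product.sigma_finite) simp
  interpret Q: pair_sigma_finite M ?P ..
  define D where "D \<omega> i = (LINT y:{0..}|lborel. damped_cos \<beta> (\<tau> i \<omega>) 0 y)" for \<omega> i
  define q where "q \<omega> i y = indicator {0..} y * (damped_cos \<beta> (\<tau> i \<omega>) 0 y * (cos (y * \<bar>a i\<bar>))\<^sup>2)" for \<omega> i y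
  have q_nonneg: "q \<omega> i y \<ge> 0" for \<omega> i y
    by (simp add: q_def damped_cos_def)
  have D_nonneg: "D \<omega> i \<ge> 0" for \<omega> i
    using pos[of i \<omega>] by (simp add: D_def damped_cos_half_line)
  have D_le: "ennreal (D \<omega> i / 2) \<le> (\<integral>\<^sup>+y. ennreal (q \<omega> i y) \<partial>lborel)" for \<omega> i
  proof -
    note sq = damped_cos_squared_half_line_ge[OF pos[of i \<omega>], of \<beta> "a i"]
    have "(\<integral>\<^sup>+y. ennreal (q \<omega> i y) \<partial>lborel) = ennreal (LINT y|lborel. q \<omega> i y)"
      using sq(1) q_nonneg[of \<omega> i] by (intro nn_integral_eq_integral) (auto simp: q_def set_integrable_def)
    then show ?thesis
      using sq(2) by (simp add: D_def q_def set_lebesgue_integral_def ennreal_leI)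
  qed
  have laplace: "(\<integral>\<^sup>+\<omega>. ennreal (\<Prod>i=1..n. damped_cos \<beta> (\<tau> i \<omega>) 0 (y i)) \<partial>M)
      = ennreal (joint_laplace M n \<tau> (\<lambda>i. (y i)\<^sup>2 / 2 + \<beta>\<^sup>2 / 2))" for y
  proof -
    have "integrable M (\<lambda>\<omega>. \<Prod>i=1..n. damped_cos \<beta> (\<tau> i \<omega>) 0 (y i))"
    proof (rule integrable_const_bound)
      show "AE \<omega> in M. norm (\<Prod>i=1..n. damped_cos \<beta> (\<tau> i \<omega>) 0 (y i)) \<le> 1"
        unfolding real_norm_def abs_prod
        by (auto intro!: AE_I2 prod_le_1 mult_nonneg_nonneg less_imp_le[OF pos] simp: damped_cos_def)
    qed simp
    then show ?thesis
      unfolding joint_laplace_def mult_minus_left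
      by (subst nn_integral_eq_integral) (auto intro!: prod_nonneg simp: damped_cos_def)
  qed
  have q_le: "(\<integral>\<^sup>+\<omega>. (\<Prod>i=1..n. ennreal (q \<omega> i (y i))) \<partial>M)
      \<le> ennreal (norm (indicator (orthant n) y *\<^sub>R cos_integrand M n \<beta> \<tau> a y))"
    if y: "y \<in> space ?P" for y
  proof -
    let ?c = "\<Prod>i=1..n. indicator {0..} (y i) * (cos (y i * \<bar>a i\<bar>))\<^sup>2"
    let ?J = "joint_laplace M n \<tau> (\<lambda>i. (y i)\<^sup>2 / 2 + \<beta>\<^sup>2 / 2)"
    have J: "?J \<ge> 0"
      unfolding joint_laplace_def by (intro integral_nonneg_AE AE_I2 prod_nonneg) auto
    have c: "?c \<ge> 0" by (intro prod_nonneg) auto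
    have "(\<Prod>i=1..n. ennreal (q \<omega> i (y i))) = ennreal ?c * ennreal (\<Prod>i=1..n. damped_cos \<beta> (\<tau> i \<omega>) 0 (y i))" for \<omega>
      using c q_nonneg by (simp add: prod_ennreal ennreal_mult'[symmetric]) (simp add: q_def prod.distrib mult_ac)
    then have "(\<integral>\<^sup>+\<omega>. (\<Prod>i=1..n. ennreal (q \<omega> i (y i))) \<partial>M) = ennreal ?c * ennreal ?J"
      by (simp add: nn_integral_cmult laplace del: One_nat_def)
    also have "\<dots> = ennreal (?c * ?J)"
      using c by (simp add: ennreal_mult')
    also have "\<dots> \<le> ennreal ((\<Prod>i=1..n. indicator {0..} (y i) * \<bar>cos (y i * \<bar>a i\<bar>)\<bar>) * ?J)"
    proof (intro ennreal_leI mult_right_mono prod_mono J conjI mult_left_mono)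
      show "(cos (y i * \<bar>a i\<bar>))\<^sup>2 \<le> \<bar>cos (y i * \<bar>a i\<bar>)\<bar>" for i
        using mult_left_le[of "\<bar>cos (y i * \<bar>a i\<bar>)\<bar>" "\<bar>cos (y i * \<bar>a i\<bar>)\<bar>"]
        by (simp add: power2_eq_square abs_mult_self_eq)
    qed auto
    also have "\<dots> = ennreal (norm (indicator (orthant n) y *\<^sub>R cos_integrand M n \<beta> \<tau> a y))"
    proof -
      have "indicator (orthant n) y = (\<Prod>i=1..n. indicator {0..} (y i) :: real)"
        using y unfolding orthant_def
        by (intro indicator_PiE_eq_prod) (auto simp: space_PiM PiE_iff)
      then show ?thesis
        using J by (simp add: cos_integrand_def prod.distrib abs_mult abs_prod mult_ac)
    qed
    finally show ?thesis .
  qed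
  have "(\<integral>\<^sup>+\<omega>. ennreal (\<Prod>i=1..n. D \<omega> i / 2) \<partial>M) = (\<integral>\<^sup>+\<omega>. (\<Prod>i=1..n. ennreal (D \<omega> i / 2)) \<partial>M)"
    using D_nonneg by (simp add: prod_ennreal)
  also have "\<dots> \<le> (\<integral>\<^sup>+\<omega>. (\<Prod>i=1..n. \<integral>\<^sup>+y. ennreal (q \<omega> i y) \<partial>lborel) \<partial>M)"
    by (intro nn_integral_mono prod_mono_ennreal D_le)
  also have "\<dots> = (\<integral>\<^sup>+\<omega>. (\<integral>\<^sup>+y. (\<Prod>i=1..n. ennreal (q \<omega> i (y i))) \<partial>?P) \<partial>M)"
    by (intro nn_integral_cong, subst lborel_product.product_nn_integral_prod) (auto simp: q_def)
  also have "\<dots> = (\<integral>\<^sup>+y. (\<integral>\<^sup>+\<omega>. (\<Prod>i=1..n. ennreal (q \<omega> i (y i))) \<partial>M) \<partial>?P)"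
    by (intro Q.Fubini'[symmetric]) (unfold q_def, measurable)
  also have "\<dots> \<le> (\<integral>\<^sup>+y. ennreal (norm (indicator (orthant n) y *\<^sub>R cos_integrand M n \<beta> \<tau> a y)) \<partial>?P)"
    by (intro nn_integral_mono q_le)
  also have "\<dots> < \<infinity>"
    using int unfolding set_integrable_def integrable_iff_bounded by simp
  finally have half: "(\<integral>\<^sup>+\<omega>. ennreal (\<Prod>i=1..n. D \<omega> i / 2) \<partial>M) < \<infinity>" .
  have [measurable]: "(\<lambda>\<omega>. \<Prod>i=1..n. D \<omega> i / 2) \<in> borel_measurable M"
    unfolding D_def by measurable
  have "ennreal (norm (\<Prod>i=1..n. D \<omega> i)) = ennreal (2 ^ n) * ennreal (\<Prod>i=1..n. D \<omega> i / 2)" for \<omega>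
    using D_nonneg by (simp add: prod_dividef abs_prod prod_nonneg ennreal_mult'[symmetric])
  then have "(\<integral>\<^sup>+\<omega>. ennreal (norm (\<Prod>i=1..n. D \<omega> i)) \<partial>M)
      = ennreal (2 ^ n) * (\<integral>\<^sup>+\<omega>. ennreal (\<Prod>i=1..n. D \<omega> i / 2) \<partial>M)"
    by (simp add: nn_integral_cmult del: One_nat_def)
  also have "\<dots> < \<infinity>"
    using half by (simp add: ennreal_mult_less_top)
  finally show "(\<integral>\<^sup>+\<omega>. ennreal (norm (\<Prod>i=1..n. LINT y:{0..}|lborel. damped_cos \<beta> (\<tau> i \<omega>) 0 y)) \<partial>M) < \<infinity>"
    unfolding D_def .
qed simp

theorem proposition4p1:
  fixes M :: "'w measure" and n :: nat and \<mu> \<beta> \<Delta> :: real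
    and \<tau> \<epsilon> X :: "nat \<Rightarrow> 'w \<Rightarrow> real"
  assumes "prob_space M" and "n \<ge> 1" and "\<Delta> > 0"
    and tau_rv: "\<And>i. i \<in> {1..n} \<Longrightarrow> \<tau> i \<in> borel_measurable M"
    and tau_pos: "\<And>i. i \<in> {1..n} \<Longrightarrow> AE \<omega> in M. 0 < \<tau> i \<omega>"
    and eps_normal: "\<And>i. i \<in> {1..n} \<Longrightarrow> distributed M lborel (\<epsilon> i) std_normal_density"
    and eps_indep: "prob_space.indep_vars M (\<lambda>_. borel) \<epsilon> {1..n}"
    and eps_tau_indep: "prob_space.indep_var M
          (PiM {1..n} (\<lambda>_. borel)) (\<lambda>\<omega>. \<lambda>i\<in>{1..n}. \<epsilon> i \<omega>)
          (PiM {1..n} (\<lambda>_. borel)) (\<lambda>\<omega>. \<lambda>i\<in>{1..n}. \<tau> i \<omega>)"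
    and model: "\<And>i \<omega>. i \<in> {1..n} \<Longrightarrow> \<omega> \<in> space M \<Longrightarrow>
          X i \<omega> = \<mu> * \<Delta> + \<beta> * \<tau> i \<omega> + sqrt (\<tau> i \<omega>) * \<epsilon> i \<omega>"
  shows "(AE \<omega> in M. \<forall>i\<in>{1..n}. resid \<mu> \<Delta> (\<lambda>j. X j \<omega>) i \<noteq> 0) \<and>
    (\<forall>x. (\<forall>i\<in>{1..n}. resid \<mu> \<Delta> x i \<noteq> 0) \<longrightarrow>
      (\<exists>I. has_orthant_integral n (cos_integrand M n \<beta> \<tau> (resid \<mu> \<Delta> x)) I \<and>
           marginal_likelihood M n \<mu> \<Delta> \<beta> \<tau> x =
             exp (real n * mean_resid n \<mu> \<Delta> x * \<beta>) / pi ^ n * I)) \<and>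
    (\<forall>x. set_integrable (PiM {1..n} (\<lambda>_. lborel)) (orthant n)
           (cos_integrand M n \<beta> \<tau> (resid \<mu> \<Delta> x)) \<longrightarrow>
      marginal_likelihood M n \<mu> \<Delta> \<beta> \<tau> x =
        exp (real n * mean_resid n \<mu> \<Delta> x * \<beta>) / pi ^ n *
        (LINT y:orthant n|PiM {1..n} (\<lambda>_. lborel). cos_integrand M n \<beta> \<tau> (resid \<mu> \<Delta> x) y))"
proof (intro conjI allI impI)
  interpret prob_space M by fact
  \<comment> \<open>Changing \<open>\<tau>\<close> on a null set and outside the index range makes it positive and measurable everywhere.\<close>
  define \<tau>' where "\<tau>' i \<omega> = (if i \<in> {1..n} \<and> \<tau> i \<omega> > 0 then \<tau> i \<omega> else 1)" for i \<omega>
  have \<tau>'_pos: "\<tau>' i \<omega> > 0" for i \<omega>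
    by (simp add: \<tau>'_def)
  have [measurable]: "\<tau>' i \<in> borel_measurable M" for i
  proof (cases "i \<in> {1..n}")
    case True
    note [measurable] = tau_rv[OF True]
    show ?thesis
      unfolding \<tau>'_def by measurable
  qed (auto simp: \<tau>'_def[abs_def])
  have AE_\<tau>': "AE \<omega> in M. \<forall>i\<in>{1..n}. \<tau>' i \<omega> = \<tau> i \<omega>"
  proof (intro AE_finite_allI)
    fix i assume i: "i \<in> {1..n}"
    from tau_pos[OF i] show "AE \<omega> in M. \<tau>' i \<omega> = \<tau> i \<omega>"
      using i by (auto simp: \<tau>'_def)
  qed simp
  note [measurable] = tau_rv
  have "joint_laplace M n \<tau> s = joint_laplace M n \<tau>' s" for s
    unfolding joint_laplace_def
  proof (rule integral_cong_AE)
    show "AE \<omega> in M. (\<Prod>i=1..n. exp (- s i * \<tau> i \<omega>)) = (\<Prod>i=1..n. exp (- s i * \<tau>' i \<omega>))"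
      using AE_\<tau>' by eventually_elim (rule prod.cong, auto)
  qed measurable
  then have cos_\<tau>': "cos_integrand M n \<beta> \<tau> a = cos_integrand M n \<beta> \<tau>' a" for a
    by (simp add: cos_integrand_def[abs_def])
  have ml_\<tau>': "marginal_likelihood M n \<mu> \<Delta> \<beta> \<tau> x = marginal_likelihood M n \<mu> \<Delta> \<beta> \<tau>' x" for x
    unfolding marginal_likelihood_def \<phi>_def normal_density_def
  proof (rule integral_cong_AE)
    let ?d = "\<lambda>i t. 1 / sqrt (2 * pi * (sqrt t)\<^sup>2) *
      exp (- (x i - (\<mu> * \<Delta> + \<beta> * t))\<^sup>2 / (2 * (sqrt t)\<^sup>2))"
    show "AE \<omega> in M. (\<Prod>i=1..n. ?d i (\<tau> i \<omega>)) = (\<Prod>i=1..n. ?d i (\<tau>' i \<omega>))"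
      using AE_\<tau>' by eventually_elim (rule prod.cong, auto)
  qed measurable
  note ml = ml_\<tau>'[unfolded marginal_likelihood_eq_cos_integrals[of \<tau>', OF \<tau>'_pos \<open>n \<ge> 1\<close>]]

  show "AE \<omega> in M. \<forall>i\<in>{1..n}. resid \<mu> \<Delta> (\<lambda>j. X j \<omega>) i \<noteq> 0"
  proof (intro AE_finite_allI)
    fix i assume i: "i \<in> {1..n}"
    have "indep_var borel ((\<lambda>v. v i) \<circ> (\<lambda>\<omega>. \<lambda>i\<in>{1..n}. \<epsilon> i \<omega>)) borel ((\<lambda>v. v i) \<circ> (\<lambda>\<omega>. \<lambda>i\<in>{1..n}. \<tau> i \<omega>))"
      using i by (intro indep_var_compose[OF eps_tau_indep]) auto
    then have "indep_var borel (\<epsilon> i) borel (\<tau> i)"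
      using i by (simp add: comp_def)
    from AE_neq_function_of_independent[OF eps_normal[OF i] this, of "\<lambda>t. - \<beta> * sqrt t"]
    have "AE \<omega> in M. \<epsilon> i \<omega> \<noteq> - \<beta> * sqrt (\<tau> i \<omega>)"
      by simp
    with tau_pos[OF i] AE_space show "AE \<omega> in M. resid \<mu> \<Delta> (\<lambda>j. X j \<omega>) i \<noteq> 0"
    proof eventually_elim
      case (elim \<omega>)
      \<comment> \<open>A residual vanishes only if \<open>\<epsilon> i\<close> equals a function of \<open>\<tau> i\<close>, which is independent of it.\<close>
      then have "resid \<mu> \<Delta> (\<lambda>j. X j \<omega>) i = sqrt (\<tau> i \<omega>) * (\<beta> * sqrt (\<tau> i \<omega>) + \<epsilon> i \<omega>)"
        using model[OF i] by (simp add: resid_def algebra_simps)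
      with elim show ?case by auto
    qed
  qed simp

  fix x
  {
    assume "\<forall>i\<in>{1..n}. resid \<mu> \<Delta> x i \<noteq> 0"
    then have "has_orthant_integral n (cos_integrand M n \<beta> \<tau>' (resid \<mu> \<Delta> x))
        (\<integral>\<omega>. (\<Prod>i=1..n. LINT y:{0..}|lborel. damped_cos \<beta> (\<tau>' i \<omega>) (resid \<mu> \<Delta> x i) y) \<partial>M)"
      by (intro has_orthant_integral_cos_integrand \<tau>'_pos \<open>prob_space M\<close>) auto
    then show "\<exists>I. has_orthant_integral n (cos_integrand M n \<beta> \<tau> (resid \<mu> \<Delta> x)) I \<and>
        marginal_likelihood M n \<mu> \<Delta> \<beta> \<tau> x = exp (real n * mean_resid n \<mu> \<Delta> x * \<beta>) / pi ^ n * I"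
      unfolding cos_\<tau>' ml
      by blast
  next
    assume "set_integrable (PiM {1..n} (\<lambda>_. lborel)) (orthant n) (cos_integrand M n \<beta> \<tau> (resid \<mu> \<Delta> x))"
    then have "integrable M (\<lambda>\<omega>. \<Prod>i=1..n. LINT y:{0..}|lborel. damped_cos \<beta> (\<tau>' i \<omega>) 0 y)"
      unfolding cos_\<tau>'
      by (intro integrable_prod_half_line_of_set_integrable \<tau>'_pos \<open>prob_space M\<close>) auto
    then show "marginal_likelihood M n \<mu> \<Delta> \<beta> \<tau> x = exp (real n * mean_resid n \<mu> \<Delta> x * \<beta>) / pi ^ n *
        (LINT y:orthant n|PiM {1..n} (\<lambda>_. lborel). cos_integrand M n \<beta> \<tau> (resid \<mu> \<Delta> x) y)"
      unfolding cos_\<tau>' ml orthant_def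
      by (subst set_integral_cos_integrand_PiE[OF \<open>prob_space M\<close> _ \<tau>'_pos]) simp_all
  }
qed

end
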